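(* Let $P(t)=a_0+a_1t+\cdots+a_dt^d$ be a polynomial with real coefficients such that $P(0)=a_0=1$ and $a_0,a_1,\ldots,a_d$ are all positive, and let $F_P(\mathbf{x})=\prod_{i\ge 1}P(x_i)$, where $\mathbf{x}=\{x_1,x_2,\ldots\}$ is a countably infinite set of indeterminates. Then the following conditions are equivalent: (i) The coefficient of the Schur function $s_\lambda(\mathbf{x})$ in $F_P(\mathbf{x})$ is nonnegative for every integer partition $\lambda$ of length at most $2$. (ii) The coefficient of $s_{(k,k)}(\mathbf{x})$ in $F_P(\mathbf{x})$ is nonnegative for every $k\ge 1$. (iii) $P(t)$ is log-concave. (iv) $P(t)$ is strongly log-concave.
   Context: The product $F_P(\mathbf{x})$ is an inhomogeneous symmetric formal power series, possibly of unbounded degree; each of its homogeneous components is a symmetric function, and the coefficient of $s_\lambda$ in $F_P$ means the coefficient of $s_\lambda$ in the Schur-basis expansion of the homogeneous component of degree $|\lambda|$. The length $\ell(\lambda)$ of a partition is its number of (nonzero) parts. A polynomial $a_0+a_1t+\cdots+a_dt^d$ is log-concave if $a_j^2\ge a_{j-1}a_{j+1}$ for all $1\le j\le d-1$. It is strongly log-concave if $a_ma_n\ge a_pa_q$ for all integers $0\le p<m\le n<q\le d$ with $m+n=p+q$. *)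

theory Defs
  imports
    Complex_Main
    "HOL-Library.Poly_Mapping"
    "HOL-Library.FuncSet"
    "HOL-Computational_Algebra.Polynomial"
begin

hide_const (open) Poly_Mapping.degree

abbreviation (input) lookup :: "('a \<Rightarrow>\<^sub>0 'b::zero) \<Rightarrow> 'a \<Rightarrow> 'b" where
  "lookup \<equiv> Poly_Mapping.lookup"

abbreviation (input) keys :: "('a \<Rightarrow>\<^sub>0 'b::zero) \<Rightarrow> 'a set" where
  "keys \<equiv> Poly_Mapping.keys"

section \<open>Formal power series in countably many variables\<close>

text \<open>
  The variables are indexed by the natural numbers, starting from 0.  A monomial is its exponent
  vector (finite support), a polynomial in these variables is a finitely supported function on
  monomials, and a formal power series is an arbitrary function on monomials, giving coefficients.
\<close>

type_synonym monom = "nat \<Rightarrow>\<^sub>0 nat"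
type_synonym series = "monom \<Rightarrow> real"

definition mdeg :: "monom \<Rightarrow> nat" where
  "mdeg m = (\<Sum>i\<in>keys m. lookup m i)"

definition hom_component :: "nat \<Rightarrow> series \<Rightarrow> series" where
  "hom_component n F = (\<lambda>m. if mdeg m = n then F m else 0)"

definition poly_at_var :: "real poly \<Rightarrow> nat \<Rightarrow> (monom \<Rightarrow>\<^sub>0 real)" where
  "poly_at_var P i =
     (\<Sum>k\<le>degree P. Poly_Mapping.single (Poly_Mapping.single i k) (coeff P k))"

text \<open>
  The infinite product of the \<open>P(x\<^sub>i)\<close> is the coefficientwise limit of its finite partial products.
  If \<open>P(0) = 1\<close>, each coefficient is eventually constant; see \<open>inf_prod_tendsto\<close> and
  \<open>inf_prod_eq\<close> below.
\<close>

definition inf_prod :: "real poly \<Rightarrow> series" where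
  "inf_prod P = (\<lambda>m. lim (\<lambda>n. lookup (\<Prod>i<n. poly_at_var P i) m))"


section \<open>Partitions and Schur functions\<close>

definition is_partition :: "nat list \<Rightarrow> bool" where
  "is_partition \<mu> \<longleftrightarrow> sorted_wrt (\<ge>) \<mu> \<and> 0 \<notin> set \<mu>"

definition partitions_of :: "nat \<Rightarrow> nat list set" where
  "partitions_of n = {\<mu>. is_partition \<mu> \<and> sum_list \<mu> = n}"

definition cells :: "nat list \<Rightarrow> (nat \<times> nat) set" where
  "cells \<mu> = {(r, c). r < length \<mu> \<and> c < \<mu> ! r}"

text \<open>
  Semistandard Young tableaux, in English notation, with entries the indices of the variables.
  A tableau is represented by a function on pairs (row, column) that is normalised to 0 outside
  the diagram, so that distinct functions are distinct tableaux.
\<close>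

definition ssyt :: "nat list \<Rightarrow> (nat \<times> nat \<Rightarrow> nat) set" where
  "ssyt \<mu> = {T.
     (\<forall>p. p \<notin> cells \<mu> \<longrightarrow> T p = 0) \<and>
     (\<forall>r c c'. (r, c) \<in> cells \<mu> \<and> (r, c') \<in> cells \<mu> \<and> c < c' \<longrightarrow> T (r, c) \<le> T (r, c')) \<and>
     (\<forall>r r' c. (r, c) \<in> cells \<mu> \<and> (r', c) \<in> cells \<mu> \<and> r < r' \<longrightarrow> T (r, c) < T (r', c))}"

definition tab_weight :: "nat list \<Rightarrow> (nat \<times> nat \<Rightarrow> nat) \<Rightarrow> monom" where
  "tab_weight \<mu> T = (\<Sum>p\<in>cells \<mu>. Poly_Mapping.single (T p) 1)"

text \<open>
  The Schur function is the sum of the monomials \<open>x\<^sup>T\<close> over all semistandard tableaux \<open>T\<close>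
  of shape \<open>\<mu>\<close>; the coefficient of a monomial counts the (finitely many, see \<open>finite_ssyt_weight\<close>)
  tableaux with that weight.
\<close>

definition schur :: "nat list \<Rightarrow> series" where
  "schur \<mu> = (\<lambda>m. real (card {T \<in> ssyt \<mu>. tab_weight \<mu> T = m}))"

text \<open>
  The coefficient of \<open>s\<^sub>\<mu>\<close> in the expansion, in the basis of Schur functions, of the homogeneous
  component of \<open>F\<close> of degree \<open>|\<mu>|\<close>.  It is meaningful when that component is a
  symmetric function; existence and uniqueness of the expansion then express that the
  \<open>s\<^sub>\<nu>\<close>, for \<open>\<nu>\<close> a partition of \<open>n\<close>, are a basis of the symmetric functions of degree \<open>n\<close>.
\<close>

definition schur_coeff :: "series \<Rightarrow> nat list \<Rightarrow> real" where
  "schur_coeff F \<mu> = (THE a. \<exists>c.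
     hom_component (sum_list \<mu>) F = (\<lambda>m. \<Sum>\<nu>\<in>partitions_of (sum_list \<mu>). c \<nu> * schur \<nu> m) \<and>
     a = c \<mu>)"


section \<open>Log-concavity\<close>

definition log_concave :: "real poly \<Rightarrow> bool" where
  "log_concave P \<longleftrightarrow>
     (\<forall>j. 1 \<le> j \<and> j < degree P \<longrightarrow> (coeff P j)\<^sup>2 \<ge> coeff P (j - 1) * coeff P (j + 1))"

definition strongly_log_concave :: "real poly \<Rightarrow> bool" where
  "strongly_log_concave P \<longleftrightarrow>
     (\<forall>p m n q. p < m \<and> m \<le> n \<and> n < q \<and> q \<le> degree P \<and> m + n = p + q \<longrightarrow>
        coeff P m * coeff P n \<ge> coeff P p * coeff P q)"


section \<open>Well-definedness\<close>

lemma lookup_partial_prod: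
  "lookup (\<Prod>i<n. poly_at_var P i) m =
     (if keys m \<subseteq> {..<n} then \<Prod>i<n. coeff P (lookup m i) else 0)"
proof -
  let ?B = "PiE {..<n} (\<lambda>_. {..degree P})"
  let ?s = "\<lambda>g. \<Sum>i<n. Poly_Mapping.single i (g i :: nat)"
  let ?g = "\<lambda>i. if i < n then lookup m i else undefined"
  have prod_single: "(\<Prod>i<k. Poly_Mapping.single (Poly_Mapping.single i (g i)) (coeff P (g i)))
      = Poly_Mapping.single (\<Sum>i<k. Poly_Mapping.single i (g i)) (\<Prod>i<k. coeff P (g i))"
    for g :: "nat \<Rightarrow> nat" and k
    by (induction k) (simp_all add: mult_single)
  have lookup_s: "lookup (?s g) j = (if j < n then g j else 0)" for g j
    by (auto simp: lookup_sum lookup_single when_def)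
  have s_eq: "?s g = m \<longleftrightarrow> keys m \<subseteq> {..<n} \<and> g = ?g" if "g \<in> ?B" for g
  proof
    assume eq: "?s g = m"
    have "keys m \<subseteq> {..<n}"
      using lookup_s[of g] unfolding eq by (auto simp: in_keys_iff split: if_splits)
    moreover have "g = ?g"
      using lookup_s[of g] that unfolding eq by (auto simp: fun_eq_iff PiE_def extensional_def)
    ultimately show "keys m \<subseteq> {..<n} \<and> g = ?g" ..
  next
    assume a: "keys m \<subseteq> {..<n} \<and> g = ?g"
    then have g: "g j = lookup m j" if "j < n" for j
      using that by simp
    show "?s g = m"
    proof (rule poly_mapping_eqI)
      fix j
      show "lookup (?s g) j = lookup m j"
        using a g[of j] unfolding lookup_s by (auto simp: in_keys_iff subset_iff)
    qed
  qed
  have fin: "finite ?B"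
    by (simp add: finite_PiE)
  have "(\<Prod>i<n. poly_at_var P i) = (\<Sum>g\<in>?B. Poly_Mapping.single (?s g) (\<Prod>i<n. coeff P (g i)))"
    unfolding poly_at_var_def by (subst prod_sum_PiE) (simp_all add: prod_single)
  then have "lookup (\<Prod>i<n. poly_at_var P i) m
      = (\<Sum>g\<in>?B. if ?s g = m then \<Prod>i<n. coeff P (g i) else 0)"
    by (simp add: lookup_sum lookup_single when_def)
  also have "\<dots> = (\<Sum>g\<in>?B. if g = ?g then
      (if keys m \<subseteq> {..<n} then \<Prod>i<n. coeff P (lookup m i) else 0) else 0)"
    by (rule sum.cong) (auto simp: s_eq intro!: prod.cong)
  also have "\<dots> = (if ?g \<in> ?B then
      (if keys m \<subseteq> {..<n} then \<Prod>i<n. coeff P (lookup m i) else 0) else 0)"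
    using fin by (simp add: sum.delta)
  also have "\<dots> = (if keys m \<subseteq> {..<n} then \<Prod>i<n. coeff P (lookup m i) else 0)"
  proof (cases "?g \<in> ?B")
    case False
    then obtain i where "i < n" "lookup m i > degree P"
      by (auto simp: PiE_def Pi_def extensional_def not_le)
    then have "(\<Prod>i<n. coeff P (lookup m i)) = 0"
      by (auto simp: prod_zero_iff coeff_eq_0 intro!: bexI[of _ i])
    with False show ?thesis by simp
  qed simp
  finally show ?thesis .
qed

lemma partial_prod_eventually:
  assumes "poly P 0 = 1"
  shows "eventually (\<lambda>n. lookup (\<Prod>i<n. poly_at_var P i) m = (\<Prod>i\<in>keys m. coeff P (lookup m i)))
           sequentially"
proof -
  obtain N where N: "keys m \<subseteq> {..<N}"
    using finite_nat_iff_bounded[of "keys m"] by auto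
  have "lookup (\<Prod>i<n. poly_at_var P i) m = (\<Prod>i\<in>keys m. coeff P (lookup m i))" if "n \<ge> N" for n
  proof -
    have sub: "keys m \<subseteq> {..<n}" using N that by auto
    have "(\<Prod>i\<in>keys m. coeff P (lookup m i)) = (\<Prod>i<n. coeff P (lookup m i))"
      using assms by (intro prod.mono_neutral_left sub) (auto simp: in_keys_iff poly_0_coeff_0)
    then show ?thesis using sub by (simp add: lookup_partial_prod)
  qed
  then show ?thesis unfolding eventually_sequentially by blast
qed

lemma inf_prod_tendsto:
  assumes "poly P 0 = 1"
  shows "(\<lambda>n. lookup (\<Prod>i<n. poly_at_var P i) m) \<longlonglongrightarrow> inf_prod P m"
    and inf_prod_eq: "inf_prod P m = (\<Prod>i\<in>keys m. coeff P (lookup m i))"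
proof -
  have "(\<lambda>n. lookup (\<Prod>i<n. poly_at_var P i) m) \<longlonglongrightarrow> (\<Prod>i\<in>keys m. coeff P (lookup m i))"
    using tendsto_eventually[OF partial_prod_eventually[OF assms]] .
  moreover from limI[OF this] show "inf_prod P m = (\<Prod>i\<in>keys m. coeff P (lookup m i))"
    by (simp add: inf_prod_def)
  ultimately show "(\<lambda>n. lookup (\<Prod>i<n. poly_at_var P i) m) \<longlonglongrightarrow> inf_prod P m"
    by simp
qed

lemma finite_partitions_of: "finite (partitions_of n)"
proof (rule finite_subset)
  have "length xs \<le> sum_list xs" if "0 \<notin> set xs" for xs :: "nat list"
    using that by (induction xs) auto
  then show "partitions_of n \<subseteq> {xs. set xs \<subseteq> {..n} \<and> length xs \<le> n}"
    using member_le_sum_list unfolding partitions_of_def is_partition_def by fastforce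
qed (simp add: finite_lists_length_le)

lemma finite_cells: "finite (cells \<mu>)"
proof -
  have "cells \<mu> = Sigma {..<length \<mu>} (\<lambda>r. {..<\<mu> ! r})"
    by (auto simp: cells_def)
  then show ?thesis by simp
qed

lemma lookup_tab_weight: "lookup (tab_weight \<mu> T) i = card {p \<in> cells \<mu>. T p = i}"
  using finite_cells[of \<mu>]
  by (auto simp: tab_weight_def lookup_sum lookup_single when_def sum.If_cases intro!: arg_cong[of _ _ card])

lemma finite_ssyt_weight: "finite {T \<in> ssyt \<mu>. tab_weight \<mu> T = m}"
proof (rule finite_subset)
  show "{T \<in> ssyt \<mu>. tab_weight \<mu> T = m}
      \<subseteq> {T. (\<forall>p. (p \<in> cells \<mu> \<longrightarrow> T p \<in> keys m) \<and> (p \<notin> cells \<mu> \<longrightarrow> T p = 0))}"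
  proof clarsimp
    fix T p q
    assume T: "T \<in> ssyt \<mu>"
    have "T (p, q) \<in> keys (tab_weight \<mu> T)" if "(p, q) \<in> cells \<mu>"
      using that finite_cells[of \<mu>] by (auto simp: in_keys_iff lookup_tab_weight)
    with T show "((p, q) \<in> cells \<mu> \<longrightarrow> T (p, q) \<in> keys (tab_weight \<mu> T)) \<and>
        ((p, q) \<notin> cells \<mu> \<longrightarrow> T (p, q) = 0)"
      by (auto simp: ssyt_def)
  qed
  show "finite {T. (\<forall>p. (p \<in> cells \<mu> \<longrightarrow> T p \<in> keys m) \<and> (p \<notin> cells \<mu> \<longrightarrow> T p = (0::nat)))}"
    by (rule finite_set_of_finite_funs) (simp_all add: finite_cells)
qed

end

(*
  Truncating to two variables determines the coefficients of the Schur functions of length at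
  most 2: for a >= b, the coefficient of s_(a,b) in a symmetric series F is the coefficient of
  x0^a x1^b minus that of x0^(a+1) x1^(b-1).  For F = F_P this is a_a a_b - a_(a+1) a_(b-1), so
  (k,k) gives log-concavity, and strong log-concavity gives all (a,b).  That the Schur expansion
  exists at all follows from the symmetry of Schur functions (Bender-Knuth) together with the
  unitriangularity of the Kostka matrix.
*)

theory Submission
  imports
    Defs
    "HOL-Combinatorics.Transposition"
begin

text \<open>\<open>schur_coeff\<close> is a definite description, so even a coefficient at a two-row
  shape has a value only once an expansion in all shapes of that size is known to exist; this is why
  Schur functions in infinitely many variables are treated. Uniqueness is argued for one coefficient
  at a time and comes out of the two-variable computation. The subtracted coefficient has its origin
  in the bialternant formula: multiplying s_(a,b)(x0,x1) by x0 - x1 leaves x0^(a+1) x1^b - x0^b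
  x1^(a+1), and the coefficient of x0^(a+1) x1^b in (x0 - x1) F(x0,x1) is the stated difference. The
  obstacle is the symmetry of Schur functions. In terms of row counts, semistandardness is a family
  of inequalities between adjacent levels, and the exchange of two letters becomes arithmetic with
  min and max.\<close>

section \<open>Tableaux as Gelfand-Tsetlin patterns\<close>

lemma cells_iff: "(r, c) \<in> cells \<mu> \<longleftrightarrow> c < nth_default 0 \<mu> r"
  by (auto simp: cells_def nth_default_def)

lemma partition_antimono:
  assumes "is_partition \<mu>" "r \<le> r'"
  shows "nth_default 0 \<mu> r' \<le> nth_default 0 \<mu> r"
  using assms by (cases "r = r'") (auto simp: is_partition_def nth_default_def sorted_wrt_iff_nth_less)

text \<open>For fixed \<open>T\<close> these numbers form its Gelfand-Tsetlin pattern: level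
  \<open>k\<close> is the shape occupied by the entries below \<open>k\<close>.\<close>

definition row_count :: "nat list \<Rightarrow> (nat \<times> nat \<Rightarrow> nat) \<Rightarrow> nat \<Rightarrow> nat \<Rightarrow> nat" where
  "row_count \<mu> T k r = card {c. (r, c) \<in> cells \<mu> \<and> T (r, c) < k}"

lemma finite_row: "finite {c. (r, c) \<in> cells \<mu> \<and> Q c}"
  by (rule finite_subset[of _ "{..<nth_default 0 \<mu> r}"]) (auto simp: cells_iff)

lemma row_count_eqI:
  assumes "\<And>c. (r, c) \<in> cells \<mu> \<Longrightarrow> T (r, c) < k \<longleftrightarrow> c < n" "n \<le> nth_default 0 \<mu> r"
  shows "row_count \<mu> T k r = n"
proof -
  have "{c. (r, c) \<in> cells \<mu> \<and> T (r, c) < k} = {..<n}"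
    using assms by (auto simp: cells_iff)
  then show ?thesis by (simp add: row_count_def)
qed

lemma row_count_le: "row_count \<mu> T k r \<le> nth_default 0 \<mu> r"
proof -
  have "row_count \<mu> T k r \<le> card {..<nth_default 0 \<mu> r}"
    unfolding row_count_def by (rule card_mono) (auto simp: cells_iff)
  then show ?thesis by simp
qed

lemma row_count_mono: "k \<le> k' \<Longrightarrow> row_count \<mu> T k r \<le> row_count \<mu> T k' r"
  unfolding row_count_def by (rule card_mono) (auto simp: finite_row)

text \<open>Rows increase weakly, so the entries below \<open>k\<close> fill an initial segment of
  the row. Hence the pattern determines the tableau.\<close>

lemma ssyt_less_iff:
  assumes T: "T \<in> ssyt \<mu>" and rc: "(r, c) \<in> cells \<mu>"
  shows "T (r, c) < k \<longleftrightarrow> c < row_count \<mu> T k r"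
proof -
  define S where "S = {c. (r, c) \<in> cells \<mu> \<and> T (r, c) < k}"
  have fin: "finite S" unfolding S_def by (rule finite_row)
  have down: "a \<in> S" if "b \<in> S" "a < b" for a b
  proof -
    have "(r, a) \<in> cells \<mu>" using that by (auto simp: S_def cells_iff)
    moreover have "T (r, a) \<le> T (r, b)"
      using T that calculation unfolding ssyt_def S_def by blast
    ultimately show ?thesis using that by (auto simp: S_def)
  qed
  define n where "n = (LEAST x. x \<notin> S)"
  have "\<exists>x. x \<notin> S" using fin ex_new_if_finite infinite_UNIV_nat by blast
  then have "n \<notin> S" unfolding n_def by (rule LeastI_ex)
  moreover have "x \<in> S" if "x < n" for x using not_less_Least[OF that[unfolded n_def]] by simp
  ultimately have "S = {..<n}" using down by (metis lessThan_iff linorder_neqE_nat subsetI subset_antisym)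
  then have "row_count \<mu> T k r = n" by (simp add: row_count_def S_def[symmetric])
  then show ?thesis using \<open>S = {..<n}\<close> rc by (auto simp: S_def)
qed

text \<open>Column strictness: above an entry at most \<open>k\<close> stands an entry below
  \<open>k\<close>.\<close>

lemma ssyt_interlace:
  assumes "is_partition \<mu>" "T \<in> ssyt \<mu>"
  shows "row_count \<mu> T (Suc k) (Suc r) \<le> row_count \<mu> T k r"
  unfolding row_count_def
proof (rule card_mono[OF finite_row], rule subsetI, clarify)
  fix c assume c: "(Suc r, c) \<in> cells \<mu>" "T (Suc r, c) < Suc k"
  then have "(r, c) \<in> cells \<mu>"
    using partition_antimono[OF assms(1), of r "Suc r"] by (simp add: cells_iff)
  moreover from this c(1) have "T (r, c) < T (Suc r, c)"
    using assms(2) unfolding ssyt_def by blast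
  ultimately show "(r, c) \<in> cells \<mu> \<and> T (r, c) < k" using c by simp
qed

text \<open>Interlacing gives column strictness for adjacent rows, and transitivity gives it for all
  rows. The thresholds \<open>n\<close> are arbitrary, so the rule applies to a modified pattern
  before its row counts are computed.\<close>

lemma ssytI_interlace:
  assumes part: "is_partition \<mu>" and out: "\<And>p. p \<notin> cells \<mu> \<Longrightarrow> T p = 0"
    and iff: "\<And>r c k. (r, c) \<in> cells \<mu> \<Longrightarrow> T (r, c) < k \<longleftrightarrow> c < n k r"
    and inter: "\<And>k r. n (Suc k) (Suc r) \<le> n k r"
  shows "T \<in> ssyt \<mu>"
proof -
  have row: "T (r, c) \<le> T (r, c')" if "(r, c) \<in> cells \<mu>" "(r, c') \<in> cells \<mu>" "c < c'" for r c c'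
    using iff[OF that(1), of "Suc (T (r, c'))"] iff[OF that(2), of "Suc (T (r, c'))"] that(3) by simp
  have col: "T (r, c) < T (r', c)" if "(r', c) \<in> cells \<mu>" "r < r'" for r r' c
    using that(2,1)
  proof (induction rule: less_Suc_induct)
    case (1 i)
    then have i: "(i, c) \<in> cells \<mu>"
      using partition_antimono[OF part, of i "Suc i"] by (simp add: cells_iff)
    have "c < n (Suc (T (Suc i, c))) (Suc i)" using iff[OF 1, of "Suc (T (Suc i, c))"] by simp
    also have "\<dots> \<le> n (T (Suc i, c)) i" by (rule inter)
    finally show ?case using iff[OF i] by simp
  next
    case (2 i j k)
    moreover have "(j, c) \<in> cells \<mu>"
      using partition_antimono[OF part, of j k] 2 by (simp add: cells_iff)
    ultimately show ?case by simp
  qed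
  show ?thesis unfolding ssyt_def using out row col by blast
qed

text \<open>The exponent of a variable is the difference of two consecutive level sums. Working over
  \<open>int\<close> lets sums over several levels be rearranged.\<close>

lemma tab_weight_row_count:
  "int (lookup (tab_weight \<mu> T) i) =
     (\<Sum>r<length \<mu>. int (row_count \<mu> T (Suc i) r) - int (row_count \<mu> T i r))"
proof -
  have row: "int (card {c. (r, c) \<in> cells \<mu> \<and> T (r, c) = i}) =
      int (row_count \<mu> T (Suc i) r) - int (row_count \<mu> T i r)" for r
  proof -
    have "{c. (r, c) \<in> cells \<mu> \<and> T (r, c) < Suc i} =
        {c. (r, c) \<in> cells \<mu> \<and> T (r, c) < i} \<union> {c. (r, c) \<in> cells \<mu> \<and> T (r, c) = i}" by auto
    then have "row_count \<mu> T (Suc i) r =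
        row_count \<mu> T i r + card {c. (r, c) \<in> cells \<mu> \<and> T (r, c) = i}"
      unfolding row_count_def by (simp only:) (rule card_Un_disjoint; auto simp: finite_row)
    then show ?thesis by simp
  qed
  have "{p \<in> cells \<mu>. T p = i} = Sigma {..<length \<mu>} (\<lambda>r. {c. (r, c) \<in> cells \<mu> \<and> T (r, c) = i})"
    by (auto simp: cells_def)
  then have "lookup (tab_weight \<mu> T) i =
      (\<Sum>r<length \<mu>. card {c. (r, c) \<in> cells \<mu> \<and> T (r, c) = i})"
    by (simp add: lookup_tab_weight finite_row)
  then show ?thesis by (simp add: row)
qed

section \<open>Symmetry of Schur functions\<close>

text \<open>
  The Bender-Knuth involution, in its piecewise linear form on Gelfand-Tsetlin patterns:
  \<open>bk_count\<close> reflects the number of entries at most \<open>i\<close> in row \<open>r\<close> in the interval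
  that interlacing with the two adjacent levels allows for it.
\<close>

definition bk_hi :: "nat list \<Rightarrow> nat \<Rightarrow> (nat \<times> nat \<Rightarrow> nat) \<Rightarrow> nat \<Rightarrow> nat" where
  "bk_hi \<mu> i T r = (case r of 0 \<Rightarrow> row_count \<mu> T (Suc (Suc i)) 0
     | Suc s \<Rightarrow> min (row_count \<mu> T (Suc (Suc i)) r) (row_count \<mu> T i s))"

definition bk_lo :: "nat list \<Rightarrow> nat \<Rightarrow> (nat \<times> nat \<Rightarrow> nat) \<Rightarrow> nat \<Rightarrow> nat" where
  "bk_lo \<mu> i T r = max (row_count \<mu> T (Suc (Suc i)) (Suc r)) (row_count \<mu> T i r)"

definition bk_count :: "nat list \<Rightarrow> nat \<Rightarrow> (nat \<times> nat \<Rightarrow> nat) \<Rightarrow> nat \<Rightarrow> nat" where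
  "bk_count \<mu> i T r = bk_lo \<mu> i T r + bk_hi \<mu> i T r - row_count \<mu> T (Suc i) r"

definition bender_knuth :: "nat list \<Rightarrow> nat \<Rightarrow> (nat \<times> nat \<Rightarrow> nat) \<Rightarrow> nat \<times> nat \<Rightarrow> nat" where
  "bender_knuth \<mu> i T p = (if p \<in> cells \<mu> \<and> (T p = i \<or> T p = Suc i)
     then (if snd p < bk_count \<mu> i T (fst p) then i else Suc i) else T p)"

context
  fixes \<mu> T and i :: nat
  assumes part: "is_partition \<mu>" and T: "T \<in> ssyt \<mu>"
begin

text \<open>A reflection maps its interval to itself. The first two bounds also keep the subtraction
  in \<open>bk_count\<close> from being truncated.\<close>

lemma bk_bounds:
  "bk_lo \<mu> i T r \<le> row_count \<mu> T (Suc i) r" "row_count \<mu> T (Suc i) r \<le> bk_hi \<mu> i T r"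
  "bk_lo \<mu> i T r \<le> bk_count \<mu> i T r" "bk_count \<mu> i T r \<le> bk_hi \<mu> i T r"
proof -
  show *: "bk_lo \<mu> i T r \<le> row_count \<mu> T (Suc i) r" "row_count \<mu> T (Suc i) r \<le> bk_hi \<mu> i T r"
    unfolding bk_lo_def bk_hi_def
    by (auto simp: row_count_mono ssyt_interlace[OF part T] split: nat.split)
  show "bk_lo \<mu> i T r \<le> bk_count \<mu> i T r" "bk_count \<mu> i T r \<le> bk_hi \<mu> i T r"
    using * by (auto simp: bk_count_def)
qed

text \<open>These are the containment and interlacing inequalities that level \<open>Suc i\<close>
  must satisfy after its replacement.\<close>

lemma bk_count_bounds:
  "row_count \<mu> T i r \<le> bk_count \<mu> i T r"
  "bk_count \<mu> i T r \<le> row_count \<mu> T (Suc (Suc i)) r"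
  "row_count \<mu> T (Suc (Suc i)) (Suc r) \<le> bk_count \<mu> i T r"
  "bk_count \<mu> i T (Suc r) \<le> row_count \<mu> T i r"
  using bk_bounds(3,4)[of r] bk_bounds(4)[of "Suc r"]
  by (auto simp: bk_lo_def bk_hi_def split: nat.splits)

text \<open>Only the letters \<open>i\<close> and \<open>Suc i\<close> are traded for each other, so
  no threshold except \<open>Suc i\<close> notices the change: one level of the pattern
  moves.\<close>

lemma bender_knuth_less_iff:
  assumes "(r, c) \<in> cells \<mu>"
  shows "bender_knuth \<mu> i T (r, c) < k \<longleftrightarrow>
    c < (if k = Suc i then bk_count \<mu> i T r else row_count \<mu> T k r)"
proof -
  note less = ssyt_less_iff[OF T assms]
  show ?thesis
  proof (cases "k = Suc i")
    case True
    have "bender_knuth \<mu> i T (r, c) < Suc i \<longleftrightarrow>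
        T (r, c) < i \<or> T (r, c) < Suc (Suc i) \<and> c < bk_count \<mu> i T r"
    proof -
      consider "T (r, c) < i" | "T (r, c) = i" | "T (r, c) = Suc i" | "T (r, c) > Suc i"
        by linarith
      then show ?thesis using assms by cases (simp_all add: bender_knuth_def)
    qed
    with True show ?thesis
      using bk_count_bounds(1,2)[of r] unfolding less by simp linarith
  next
    case False
    then have "bender_knuth \<mu> i T (r, c) < k \<longleftrightarrow> T (r, c) < k"
      by (cases "k \<le> i") (auto simp: bender_knuth_def)
    then show ?thesis using less[of k] False by simp
  qed
qed

lemma bender_knuth_ssyt: "bender_knuth \<mu> i T \<in> ssyt \<mu>"
proof (rule ssytI_interlace[OF part, where n =
      "\<lambda>k r. if k = Suc i then bk_count \<mu> i T r else row_count \<mu> T k r"])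
  show "bender_knuth \<mu> i T p = 0" if "p \<notin> cells \<mu>" for p
    using T that by (cases p) (simp add: bender_knuth_def ssyt_def)
next
  fix k r
  show "(if Suc k = Suc i then bk_count \<mu> i T (Suc r) else row_count \<mu> T (Suc k) (Suc r))
      \<le> (if k = Suc i then bk_count \<mu> i T r else row_count \<mu> T k r)"
    using bk_count_bounds[of r] ssyt_interlace[OF part T, of k r] by auto
qed (rule bender_knuth_less_iff)

lemma row_count_bender_knuth:
  "row_count \<mu> (bender_knuth \<mu> i T) k r =
     (if k = Suc i then bk_count \<mu> i T r else row_count \<mu> T k r)"
proof (rule row_count_eqI[OF bender_knuth_less_iff])
  show "(if k = Suc i then bk_count \<mu> i T r else row_count \<mu> T k r) \<le> nth_default 0 \<mu> r"
    using order.trans[OF bk_count_bounds(2)[of r] row_count_le] by (simp add: row_count_le)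
qed

text \<open>The interval ends depend only on levels \<open>i\<close> and \<open>Suc (Suc i)\<close>,
  which stay fixed, so the second pass reflects in the same intervals.\<close>

lemma bender_knuth_involution: "bender_knuth \<mu> i (bender_knuth \<mu> i T) = T"
proof
  fix p :: "nat \<times> nat"
  obtain r c where p: "p = (r, c)" by fastforce
  have "bk_lo \<mu> i (bender_knuth \<mu> i T) r = bk_lo \<mu> i T r"
    "bk_hi \<mu> i (bender_knuth \<mu> i T) r = bk_hi \<mu> i T r"
    by (auto simp: bk_lo_def bk_hi_def row_count_bender_knuth split: nat.split)
  then have "bk_count \<mu> i (bender_knuth \<mu> i T) r = row_count \<mu> T (Suc i) r"
    using bk_bounds[of r] by (simp add: bk_count_def row_count_bender_knuth)
  then have twice: "bender_knuth \<mu> i (bender_knuth \<mu> i T) p =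
      (if p \<in> cells \<mu> \<and> (T p = i \<or> T p = Suc i)
       then (if c < row_count \<mu> T (Suc i) r then i else Suc i) else T p)"
    unfolding bender_knuth_def[of \<mu> i "bender_knuth \<mu> i T"]
    by (simp add: p) (simp add: bender_knuth_def)
  show "bender_knuth \<mu> i (bender_knuth \<mu> i T) p = T p"
  proof (cases "p \<in> cells \<mu>")
    case True
    then show ?thesis
      unfolding twice unfolding p by (subst ssyt_less_iff[OF T, symmetric]) auto
  qed (simp add: twice)
qed

lemma sum_bk_count:
  "(\<Sum>r<length \<mu>. int (bk_count \<mu> i T r)) =
     (\<Sum>r<length \<mu>. int (row_count \<mu> T i r) + int (row_count \<mu> T (Suc (Suc i)) r)
        - int (row_count \<mu> T (Suc i) r))"
proof -
  \<comment> \<open>\<open>bk_lo\<close> of a row and \<open>bk_hi\<close> of the next row are the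
    max and min of the same two counts, so they add up to the sum of these counts. The unpaired
    \<open>bk_hi\<close> at \<open>l\<close> vanishes for \<open>l = length \<mu>\<close>.\<close>
  have telescope: "(\<Sum>r<l. int (bk_lo \<mu> i T r) + int (bk_hi \<mu> i T r)) + int (bk_hi \<mu> i T l) =
      (\<Sum>r<l. int (row_count \<mu> T i r) + int (row_count \<mu> T (Suc (Suc i)) r))
        + int (row_count \<mu> T (Suc (Suc i)) l)" for l
  proof (induction l)
    case (Suc l)
    have "int (bk_lo \<mu> i T l) + int (bk_hi \<mu> i T (Suc l)) =
        int (row_count \<mu> T i l) + int (row_count \<mu> T (Suc (Suc i)) (Suc l))"
      by (auto simp: bk_lo_def bk_hi_def)
    with Suc show ?case by simp
  qed (simp add: bk_hi_def)
  have "row_count \<mu> T (Suc (Suc i)) (length \<mu>) = 0" "bk_hi \<mu> i T (length \<mu>) = 0"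
    using row_count_le[of \<mu> T _ "length \<mu>"]
    by (auto simp: nth_default_def bk_hi_def split: nat.split)
  moreover have "int (bk_count \<mu> i T r) =
      int (bk_lo \<mu> i T r) + int (bk_hi \<mu> i T r) - int (row_count \<mu> T (Suc i) r)" for r
    using bk_bounds(1,2)[of r] by (simp add: bk_count_def)
  ultimately show ?thesis
    using telescope[of "length \<mu>"] by (simp add: sum_subtractf)
qed

text \<open>Reflecting the middle one of three consecutive level sums swaps the two differences
  between them, which are the exponents at \<open>i\<close> and \<open>Suc i\<close>.\<close>

lemma tab_weight_bender_knuth:
  "tab_weight \<mu> (bender_knuth \<mu> i T) =
     Poly_Mapping.map_key (transpose i (Suc i)) (tab_weight \<mu> T)"
proof (rule poly_mapping_eqI)
  fix j
  have "int (lookup (tab_weight \<mu> (bender_knuth \<mu> i T)) j)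
      = int (lookup (tab_weight \<mu> T) (transpose i (Suc i) j))"
  proof -
    consider "j = i" | "j = Suc i" | "j \<noteq> i" "j \<noteq> Suc i" by blast
    then show ?thesis
      unfolding tab_weight_row_count row_count_bender_knuth
      by cases (simp_all add: sum_subtractf sum.distrib sum_bk_count transpose_def)
  qed
  then show "lookup (tab_weight \<mu> (bender_knuth \<mu> i T)) j =
      lookup (Poly_Mapping.map_key (transpose i (Suc i)) (tab_weight \<mu> T)) j"
    unfolding map_key.rep_eq[OF inj_transpose] o_def by (simp only: of_nat_eq_iff)
qed

end

text \<open>Adjacent transpositions generate all finitary permutations; they are what the involution
  supplies and what sorting an exponent vector uses.\<close>

definition symmetric_series :: "series \<Rightarrow> bool" where
  "symmetric_series F \<longleftrightarrow> (\<forall>i m. F (Poly_Mapping.map_key (transpose i (Suc i)) m) = F m)"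

lemma symmetric_seriesD:
  "symmetric_series F \<Longrightarrow> F (Poly_Mapping.map_key (transpose i (Suc i)) m) = F m"
  by (simp add: symmetric_series_def)

lemma lookup_map_key_transpose:
  "lookup (Poly_Mapping.map_key (transpose i j) m) k = lookup m (transpose i j k)"
  unfolding map_key.rep_eq[OF inj_transpose] o_def ..

lemma map_key_transpose_involutory:
  "Poly_Mapping.map_key (transpose i j) (Poly_Mapping.map_key (transpose i j) m) = m"
  by (rule poly_mapping_eqI) (simp only: lookup_map_key_transpose transpose_involutory)

lemma bij_betw_keys_transpose:
  "bij_betw (transpose i j) (keys (Poly_Mapping.map_key (transpose i j) m)) (keys m)"
  unfolding keys_map_key[OF inj_transpose] bij_betw_def
  by (simp add: surj_image_vimage_eq[OF surj_transpose])

lemma symmetric_schur: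
  assumes "is_partition \<mu>"
  shows "symmetric_series (schur \<mu>)"
  unfolding symmetric_series_def
proof (intro allI)
  fix i m
  have "bij_betw (bender_knuth \<mu> i) {T \<in> ssyt \<mu>. tab_weight \<mu> T = m}
      {T \<in> ssyt \<mu>. tab_weight \<mu> T = Poly_Mapping.map_key (transpose i (Suc i)) m}"
    by (rule bij_betw_byWitness[where f' = "bender_knuth \<mu> i"])
      (auto simp: bender_knuth_involution bender_knuth_ssyt tab_weight_bender_knuth assms
        map_key_transpose_involutory)
  then show "schur \<mu> (Poly_Mapping.map_key (transpose i (Suc i)) m) = schur \<mu> m"
    unfolding schur_def by (simp add: bij_betw_same_card)
qed

section \<open>Schur expansion of symmetric series\<close>

text \<open>Weight 1 gives the degree. Weight \<open>id\<close> gives the total of the entries of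
  any tableau with weight \<open>m\<close>, the statistic behind both triangularity and
  sorting.\<close>

definition wsum :: "(nat \<Rightarrow> nat) \<Rightarrow> monom \<Rightarrow> nat" where
  "wsum f m = (\<Sum>i\<in>keys m. f i * lookup m i)"

lemma mdeg_wsum: "mdeg m = wsum (\<lambda>_. 1) m"
  by (simp add: mdeg_def wsum_def)

lemma wsum_superset:
  assumes "finite A" "keys m \<subseteq> A"
  shows "wsum f m = (\<Sum>i\<in>A. f i * lookup m i)"
  unfolding wsum_def using assms by (intro sum.mono_neutral_left) (auto simp: in_keys_iff)

lemma wsum_map_key:
  "wsum f (Poly_Mapping.map_key (transpose i j) m) = wsum (f \<circ> transpose i j) m"
  unfolding wsum_def lookup_map_key_transpose
  by (subst sum.reindex_bij_betw[OF bij_betw_keys_transpose[of i j m], symmetric])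
    (simp add: transpose_involutory)

lemma wsum_add: "wsum f (m + m') = wsum f m + wsum f m'"
proof -
  have "finite (keys m \<union> keys m')" by simp
  from wsum_superset[OF this, of "m + m'" f] wsum_superset[OF this, of m f]
    wsum_superset[OF this, of m' f] keys_add[of m m']
  show ?thesis by (simp add: lookup_add algebra_simps sum.distrib)
qed

lemma wsum_tab_weight: "wsum f (tab_weight \<mu> T) = (\<Sum>p\<in>cells \<mu>. f (T p))"
proof -
  have "wsum f (\<Sum>p\<in>A. Poly_Mapping.single (T p) 1) = (\<Sum>p\<in>A. f (T p))" if "finite A" for A
    using that
  proof induction
    case (insert x A)
    have "wsum f (Poly_Mapping.single (T x) 1) = f (T x)" by (simp add: wsum_def)
    with insert show ?case by (simp add: wsum_add)
  qed (simp add: wsum_def)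
  then show ?thesis by (simp add: tab_weight_def finite_cells)
qed

text \<open>\<open>fst\<close> fills each cell with its row index. It is not normalised to 0 outside
  the diagram, but the weight reads only the cells.\<close>

lemma tab_weight_fst: "tab_weight \<mu> fst = Poly_Mapping.nth \<mu>"
proof (rule poly_mapping_eqI)
  fix i
  have "{p \<in> cells \<mu>. fst p = i} = {i} \<times> {..<nth_default 0 \<mu> i}"
    by (auto simp: cells_iff)
  then show "lookup (tab_weight \<mu> fst) i = lookup (Poly_Mapping.nth \<mu>) i"
    by (simp add: lookup_tab_weight card_cartesian_product)
qed

lemma card_cells: "card (cells \<mu>) = sum_list \<mu>"
proof -
  have "cells \<mu> = Sigma {..<length \<mu>} (\<lambda>r. {..<\<mu> ! r})"
    by (auto simp: cells_def)
  then show ?thesis by (simp add: sum_list_sum_nth atLeast0LessThan)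
qed

lemma mdeg_tab_weight: "mdeg (tab_weight \<mu> T) = sum_list \<mu>"
  by (simp add: mdeg_wsum wsum_tab_weight card_cells)

lemma mdeg_nth: "mdeg (Poly_Mapping.nth \<mu>) = sum_list \<mu>"
  using mdeg_tab_weight[of \<mu> fst] by (simp add: tab_weight_fst)

section \<open>Unitriangularity of the Kostka matrix\<close>

lemma schur_nonzeroD: "schur \<mu> m \<noteq> 0 \<Longrightarrow> \<exists>T\<in>ssyt \<mu>. tab_weight \<mu> T = m"
  by (auto simp: schur_def card_eq_0_iff)

lemma ssyt_ge_row:
  assumes "is_partition \<mu>" "T \<in> ssyt \<mu>" "(r, c) \<in> cells \<mu>"
  shows "r \<le> T (r, c)"
  using assms(3)
proof (induction r)
  case (Suc r)
  have "(r, c) \<in> cells \<mu>"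
    using partition_antimono[OF assms(1), of r "Suc r"] Suc.prems by (simp add: cells_iff)
  moreover from this have "T (r, c) < T (Suc r, c)"
    using assms(2) Suc.prems unfolding ssyt_def by blast
  ultimately show ?case using Suc.IH by simp
qed simp

text \<open>
  Entries in row \<open>r\<close> are at least \<open>r\<close>, so the total of the entries is minimal exactly for the
  tableau with all entries equal to their row index.  Hence the Kostka matrix is unitriangular
  with respect to \<open>wsum id\<close>, and dominance order is not needed.
\<close>

lemma ssyt_minimal:
  assumes "is_partition \<mu>" "T \<in> ssyt \<mu>"
    and "wsum id (tab_weight \<mu> T) \<le> wsum id (Poly_Mapping.nth \<mu>)"
    and "p \<in> cells \<mu>"
  shows "T p = fst p"
proof -
  have ge: "fst q \<le> T q" if "q \<in> cells \<mu>" for q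
    using ssyt_ge_row[OF assms(1,2), of "fst q" "snd q"] that by simp
  have "(\<Sum>q\<in>cells \<mu>. T q) \<le> (\<Sum>q\<in>cells \<mu>. fst q)"
    using assms(3) by (simp add: tab_weight_fst[symmetric] wsum_tab_weight)
  then have "(\<Sum>q\<in>cells \<mu>. fst q) = (\<Sum>q\<in>cells \<mu>. T q)"
    using ge by (metis antisym sum_mono)
  from sum_mono_inv[OF this ge assms(4) finite_cells] show ?thesis by simp
qed

lemma schur_triangular:
  assumes "is_partition \<mu>" "schur \<mu> m \<noteq> 0" "wsum id m \<le> wsum id (Poly_Mapping.nth \<mu>)"
  shows "m = Poly_Mapping.nth \<mu>"
proof -
  obtain T where T: "T \<in> ssyt \<mu>" "tab_weight \<mu> T = m"
    using schur_nonzeroD[OF assms(2)] by blast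
  have "T p = fst p" if "p \<in> cells \<mu>" for p
    using ssyt_minimal[OF assms(1) T(1) _ that] assms(3) T(2) by simp
  then have "tab_weight \<mu> T = tab_weight \<mu> fst" by (simp add: tab_weight_def)
  then show ?thesis using T by (simp add: tab_weight_fst)
qed

lemma schur_diagonal:
  assumes "is_partition \<mu>"
  shows "schur \<mu> (Poly_Mapping.nth \<mu>) = 1"
proof -
  define T0 where "T0 p = (if p \<in> cells \<mu> then fst p else 0)" for p :: "nat \<times> nat"
  have "T0 \<in> ssyt \<mu>" by (auto simp: ssyt_def T0_def)
  moreover have "tab_weight \<mu> T0 = Poly_Mapping.nth \<mu>"
    by (simp add: tab_weight_fst[symmetric] tab_weight_def T0_def)
  moreover have "T = T0" if T: "T \<in> ssyt \<mu>" "tab_weight \<mu> T = Poly_Mapping.nth \<mu>" for T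
  proof
    fix p
    show "T p = T0 p"
    proof (cases "p \<in> cells \<mu>")
      case True
      then show ?thesis using ssyt_minimal[OF assms T(1)] T(2) by (simp add: T0_def)
    next
      case False
      then show ?thesis using T(1) by (cases p) (simp add: ssyt_def T0_def)
    qed
  qed
  ultimately have "{T \<in> ssyt \<mu>. tab_weight \<mu> T = Poly_Mapping.nth \<mu>} = {T0}" by blast
  then show ?thesis by (simp add: schur_def)
qed

section \<open>Sorting exponent vectors into partitions\<close>

lemma partition_nth_inject:
  assumes "is_partition \<mu>" "is_partition \<nu>" "Poly_Mapping.nth \<mu> = Poly_Mapping.nth \<nu>"
  shows "\<mu> = \<nu>"
proof -
  \<comment> \<open>\<open>Poly_Mapping.nth\<close> forgets trailing zeros only, and a partition has
    none.\<close>
  have "strip_while (HOL.eq 0) xs = xs" if "is_partition xs" for xs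
    using that by (induction xs rule: rev_induct) (auto simp: is_partition_def)
  then show ?thesis using assms by (simp add: nth_eq_iff)
qed

lemma decreasing_monom_partition:
  assumes "\<And>i. lookup m (Suc i) \<le> lookup m i"
  obtains \<mu> where "is_partition \<mu>" "m = Poly_Mapping.nth \<mu>"
proof -
  have anti: "lookup m j \<le> lookup m i" if "i \<le> j" for i j
    using lift_Suc_antimono_le[of "lookup m", OF assms that] .
  define N where "N = (LEAST i. lookup m i = 0)"
  have "\<exists>i. lookup m i = 0"
    using ex_new_if_finite[OF infinite_UNIV_nat finite_keys[of m]] by (auto simp: in_keys_iff)
  then have N: "lookup m N = 0" unfolding N_def by (rule LeastI_ex)
  have pos: "lookup m i \<noteq> 0" if "i < N" for i
    using not_less_Least[OF that[unfolded N_def]] .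
  show thesis
  proof
    show "is_partition (map (lookup m) [0..<N])"
      using anti pos by (force simp: is_partition_def sorted_wrt_iff_nth_less)
    show "m = Poly_Mapping.nth (map (lookup m) [0..<N])"
    proof (rule poly_mapping_eqI)
      fix i
      show "lookup m i = lookup (Poly_Mapping.nth (map (lookup m) [0..<N])) i"
        using anti[of N i] N by (simp add: nth_default_def)
    qed
  qed
qed

text \<open>Moving the larger exponent to the smaller index lowers the sum by the difference of the
  two exponents. This is the termination measure of bubble sort.\<close>

lemma wsum_transpose_less:
  assumes "lookup m i < lookup m (Suc i)"
  shows "wsum id (Poly_Mapping.map_key (transpose i (Suc i)) m) < wsum id m"
proof -
  define B where "B = keys m - {i, Suc i}"
  have A: "finite (insert i (insert (Suc i) B))" "keys m \<subseteq> insert i (insert (Suc i) B)"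
    by (auto simp: B_def)
  have B: "finite B" "i \<notin> B" "Suc i \<notin> B" by (auto simp: B_def)
  have "(\<Sum>j\<in>B. transpose i (Suc i) j * lookup m j) = (\<Sum>j\<in>B. j * lookup m j)"
    by (intro sum.cong) (auto simp: B_def transpose_def)
  with B assms show ?thesis
    unfolding wsum_map_key wsum_superset[OF A] by (simp add: transpose_def)
qed

lemma symmetric_series_eqI:
  assumes F: "symmetric_series F" and G: "symmetric_series G"
    and eq: "\<And>\<mu>. is_partition \<mu> \<Longrightarrow> F (Poly_Mapping.nth \<mu>) = G (Poly_Mapping.nth \<mu>)"
  shows "F = G"
proof
  fix m
  show "F m = G m"
  proof (induction "wsum id m" arbitrary: m rule: less_induct)
    case less
    show ?case
    proof (cases "\<forall>i. lookup m (Suc i) \<le> lookup m i")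
      case True
      then show ?thesis using decreasing_monom_partition[of m] eq by metis
    next
      case False
      then obtain i where "lookup m i < lookup m (Suc i)" by (auto simp: not_le)
      from less[OF wsum_transpose_less[OF this]] show ?thesis
        by (simp only: symmetric_seriesD[OF F] symmetric_seriesD[OF G])
    qed
  qed
qed

text \<open>Forward substitution in a unitriangular system, adding shapes in order of
  \<open>wsum id\<close>. By symmetry, agreement on partition monomials gives agreement
  everywhere.\<close>

lemma schur_expansion:
  assumes F: "symmetric_series F"
  shows "\<exists>c. hom_component n F = (\<lambda>m. \<Sum>\<nu>\<in>partitions_of n. c \<nu> * schur \<nu> m)"
proof -
  have part: "is_partition \<nu>" if "\<nu> \<in> partitions_of n" for \<nu>
    using that by (simp add: partitions_of_def)
  have "\<exists>c. \<forall>\<mu>\<in>S. F (Poly_Mapping.nth \<mu>) = (\<Sum>\<nu>\<in>S. c \<nu> * schur \<nu> (Poly_Mapping.nth \<mu>))"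
    if "finite S" "\<forall>\<nu>\<in>S. is_partition \<nu>" for S
    using that
  proof (induction S rule: finite_ranking_induct[where f = "\<lambda>\<mu>. wsum id (Poly_Mapping.nth \<mu>)"])
    case empty
    then show ?case by simp
  next
    case (insert x S)
    show ?case
    proof (cases "x \<in> S")
      case True
      with insert show ?thesis by (simp add: insert_absorb)
    next
      case False
      from insert obtain c where
        c: "F (Poly_Mapping.nth \<mu>) = (\<Sum>\<nu>\<in>S. c \<nu> * schur \<nu> (Poly_Mapping.nth \<mu>))" if "\<mu> \<in> S" for \<mu>
        by auto
      define cx where "cx = F (Poly_Mapping.nth x) - (\<Sum>\<nu>\<in>S. c \<nu> * schur \<nu> (Poly_Mapping.nth x))"
      \<comment> \<open>The new shape leaves the earlier equations intact. Ties in the ranking are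
        harmless, since \<open>schur_triangular\<close> would force
        \<open>\<mu> = x\<close>.\<close>
      have zero: "schur x (Poly_Mapping.nth \<mu>) = 0" if "\<mu> \<in> S" for \<mu>
        using schur_triangular[of x "Poly_Mapping.nth \<mu>"] partition_nth_inject[of \<mu> x]
          insert.hyps(2)[OF that] insert.prems that False by auto
      have sum: "(\<Sum>\<nu>\<in>insert x S. (c(x := cx)) \<nu> * schur \<nu> m) =
          cx * schur x m + (\<Sum>\<nu>\<in>S. c \<nu> * schur \<nu> m)" for m
        using insert.hyps(1) False by (auto intro!: sum.cong)
      have "F (Poly_Mapping.nth \<mu>) =
          (\<Sum>\<nu>\<in>insert x S. (c(x := cx)) \<nu> * schur \<nu> (Poly_Mapping.nth \<mu>))"
        if "\<mu> \<in> insert x S" for \<mu>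
        unfolding sum using that c zero schur_diagonal insert.prems by (auto simp: cx_def)
      then show ?thesis by blast
    qed
  qed
  from this[OF finite_partitions_of[of n]] part obtain c where
    c: "F (Poly_Mapping.nth \<mu>) = (\<Sum>\<nu>\<in>partitions_of n. c \<nu> * schur \<nu> (Poly_Mapping.nth \<mu>))"
    if "\<mu> \<in> partitions_of n" for \<mu> by blast
  have "hom_component n F = (\<lambda>m. \<Sum>\<nu>\<in>partitions_of n. c \<nu> * schur \<nu> m)"
  proof (rule symmetric_series_eqI)
    show "symmetric_series (hom_component n F)"
      unfolding symmetric_series_def hom_component_def mdeg_wsum wsum_map_key
      by (simp add: symmetric_seriesD[OF F] comp_def)
    show "symmetric_series (\<lambda>m. \<Sum>\<nu>\<in>partitions_of n. c \<nu> * schur \<nu> m)"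
      unfolding symmetric_series_def
      by (intro allI sum.cong refl) (simp add: symmetric_seriesD[OF symmetric_schur[OF part]])
  next
    fix \<mu> assume \<mu>: "is_partition \<mu>"
    show "hom_component n F (Poly_Mapping.nth \<mu>) =
        (\<Sum>\<nu>\<in>partitions_of n. c \<nu> * schur \<nu> (Poly_Mapping.nth \<mu>))"
    proof (cases "sum_list \<mu> = n")
      case True
      then have "\<mu> \<in> partitions_of n" using \<mu> by (simp add: partitions_of_def)
      from c[OF this] True show ?thesis by (simp add: hom_component_def mdeg_nth)
    next
      case False
      have "schur \<nu> (Poly_Mapping.nth \<mu>) = 0" if "\<nu> \<in> partitions_of n" for \<nu>
        using schur_nonzeroD[of \<nu> "Poly_Mapping.nth \<mu>"] mdeg_tab_weight mdeg_nth that False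
        by (metis (mono_tags, lifting) mem_Collect_eq partitions_of_def)
      then show ?thesis using False by (simp add: hom_component_def mdeg_nth)
    qed
  qed
  then show ?thesis by (rule exI[of _ c])
qed

section \<open>Coefficients of Schur functions of length at most two\<close>

lemma cells_length_le_2:
  assumes "length \<nu> \<le> 2"
  shows "cells \<nu> = {0} \<times> {..<nth_default 0 \<nu> 0} \<union> {1} \<times> {..<nth_default 0 \<nu> 1}"
proof -
  have "r = 0 \<or> r = 1" if "(r, c) \<in> cells \<nu>" for r c
    using that assms by (auto simp: cells_def)
  then show ?thesis using cells_iff[of _ _ \<nu>] by fastforce
qed

lemma sum_list_length_le_2:
  fixes \<nu> :: "nat list"
  assumes "length \<nu> \<le> 2"
  shows "sum_list \<nu> = nth_default 0 \<nu> 0 + nth_default 0 \<nu> 1"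
  unfolding card_cells[symmetric] cells_length_le_2[OF assms]
  by (subst card_Un_disjoint) (auto simp: card_cartesian_product)

text \<open>Only the letters 0 and 1 occur, so columns have height at most 2 and row 1 consists of
  ones. Row 0 then holds all \<open>a\<close> zeros, and the shape determines the tableau.\<close>

lemma ssyt_two_letters:
  assumes \<nu>: "is_partition \<nu>" and T: "T \<in> ssyt \<nu>" "tab_weight \<nu> T = Poly_Mapping.nth [a, b]"
  shows "length \<nu> \<le> 2" "a \<le> nth_default 0 \<nu> 0"
    and "p \<in> cells \<nu> \<Longrightarrow> T p = (if fst p = 0 \<and> snd p < a then 0 else 1)"
proof -
  have count: "card {p \<in> cells \<nu>. T p = i} = nth_default 0 [a, b] i" for i
    using T(2) lookup_tab_weight[of \<nu> T i] by simp
  have lt: "T p < 2" if "p \<in> cells \<nu>" for p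
  proof (rule ccontr)
    assume "\<not> T p < 2"
    then have "card {q \<in> cells \<nu>. T q = T p} = 0"
      unfolding count by (simp add: nth_default_def)
    with that show False by (cases p) (auto simp: finite_cells)
  qed
  have ge: "r \<le> T (r, c)" if "(r, c) \<in> cells \<nu>" for r c
    using ssyt_ge_row[OF \<nu> T(1) that] .
  show "length \<nu> \<le> 2"
  proof (rule ccontr)
    assume "\<not> length \<nu> \<le> 2"
    then have "\<nu> ! 2 \<noteq> 0" using \<nu> by (metis is_partition_def not_le nth_mem)
    with \<open>\<not> length \<nu> \<le> 2\<close> have "(2, 0) \<in> cells \<nu>" by (simp add: cells_def)
    with lt ge show False by fastforce
  qed
  have "{p \<in> cells \<nu>. T p = 0} = {0} \<times> {c. (0, c) \<in> cells \<nu> \<and> T (0, c) < 1}"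
    using ge by fastforce
  then have a: "row_count \<nu> T 1 0 = a"
    using count[of 0] by (simp add: row_count_def card_cartesian_product)
  then show "a \<le> nth_default 0 \<nu> 0" using row_count_le[of \<nu> T 1 0] by simp
  show "T p = (if fst p = 0 \<and> snd p < a then 0 else 1)" if p: "p \<in> cells \<nu>"
  proof -
    obtain r c where rc: "p = (r, c)" by fastforce
    show ?thesis
    proof (cases "r = 0")
      case True
      then show ?thesis using ssyt_less_iff[OF T(1), of r c 1] a lt[OF p] p rc by auto
    next
      case False
      then show ?thesis using ge[of r c] lt[OF p] p rc by auto
    qed
  qed
qed

lemma schur_two_letters:
  assumes \<nu>: "is_partition \<nu>" and sum: "sum_list \<nu> = a + b" and "b \<le> a"
  shows "schur \<nu> (Poly_Mapping.nth [a, b]) = of_bool (length \<nu> \<le> 2 \<and> nth_default 0 \<nu> 1 \<le> b)"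
proof (cases "length \<nu> \<le> 2 \<and> nth_default 0 \<nu> 1 \<le> b")
  case False
  have "\<not> (T \<in> ssyt \<nu> \<and> tab_weight \<nu> T = Poly_Mapping.nth [a, b])" for T
    using ssyt_two_letters(1,2)[OF \<nu>, of T a b] sum_list_length_le_2[of \<nu>] sum False by auto
  then have "{T \<in> ssyt \<nu>. tab_weight \<nu> T = Poly_Mapping.nth [a, b]} = {}" by blast
  then show ?thesis using False by (simp only: schur_def) simp
next
  case True
  define q where "q = nth_default 0 \<nu> 1"
  have q: "q \<le> b" "nth_default 0 \<nu> 0 = a + (b - q)"
    using True sum_list_length_le_2[of \<nu>] sum by (auto simp: q_def)
  have cells: "cells \<nu> = {0} \<times> {..<a + (b - q)} \<union> {1} \<times> {..<q}"
    using cells_length_le_2[of \<nu>] True q by (simp add: q_def)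
  define T0 where "T0 p = (if p \<in> cells \<nu> \<and> \<not> (fst p = 0 \<and> snd p < a) then 1 else 0 :: nat)"
    for p :: "nat \<times> nat"
  \<comment> \<open>As \<open>q \<le> b \<le> a\<close>, every cell of row 1 lies below one of the
    zeros of row 0.\<close>
  have "T0 \<in> ssyt \<nu>" using q(1) \<open>b \<le> a\<close> by (auto simp: ssyt_def T0_def cells)
  moreover have "tab_weight \<nu> T0 = Poly_Mapping.nth [a, b]"
  proof (rule poly_mapping_eqI)
    fix i :: nat
    have 0: "{p \<in> cells \<nu>. T0 p = 0} = {0} \<times> {..<a}" by (auto simp: T0_def cells)
    have 1: "{p \<in> cells \<nu>. T0 p = 1} = {0} \<times> {a..<a + (b - q)} \<union> {1} \<times> {..<q}"
      by (auto simp: T0_def cells)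
    have 2: "card {p \<in> cells \<nu>. T0 p = 1} = b"
      unfolding 1 using q(1) by (subst card_Un_disjoint) (auto simp: card_cartesian_product)
    consider "i = 0" | "i = 1" | "i \<ge> 2" by linarith
    then show "lookup (tab_weight \<nu> T0) i = lookup (Poly_Mapping.nth [a, b]) i"
    proof cases
      case 3
      then have "{p \<in> cells \<nu>. T0 p = i} = {}" by (auto simp: T0_def)
      with 3 show ?thesis by (simp only: lookup_tab_weight) (simp add: nth_default_def)
    qed (use 0 2 in \<open>simp_all add: lookup_tab_weight card_cartesian_product nth_default_def\<close>)
  qed
  moreover have "T = T0" if T: "T \<in> ssyt \<nu>" "tab_weight \<nu> T = Poly_Mapping.nth [a, b]" for T
  proof
    fix p
    show "T p = T0 p"
    proof (cases "p \<in> cells \<nu>")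
      case True
      then show ?thesis using ssyt_two_letters(3)[OF \<nu> T] by (simp add: T0_def)
    next
      case False
      then show ?thesis using T(1) by (cases p) (simp add: ssyt_def T0_def)
    qed
  qed
  ultimately have "{T \<in> ssyt \<nu>. tab_weight \<nu> T = Poly_Mapping.nth [a, b]} = {T0}" by blast
  then show ?thesis using True by (simp add: schur_def)
qed

lemma partition_length_le_2_eqI:
  assumes "is_partition \<mu>" "is_partition \<nu>" "length \<mu> \<le> 2" "length \<nu> \<le> 2"
    and "sum_list \<mu> = sum_list \<nu>" "nth_default 0 \<mu> 1 = nth_default 0 \<nu> 1"
  shows "\<mu> = \<nu>"
proof (rule partition_nth_inject[OF assms(1,2)], rule poly_mapping_eqI)
  fix i :: nat
  consider "i = 0" | "i = 1" | "i \<ge> 2" by linarith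
  then show "lookup (Poly_Mapping.nth \<mu>) i = lookup (Poly_Mapping.nth \<nu>) i"
    using assms sum_list_length_le_2[of \<mu>] sum_list_length_le_2[of \<nu>]
    by cases (simp_all add: nth_default_def)
qed

text \<open>
  The monomial \<open>x\<^sub>0\<^sup>a x\<^sub>1\<^sup>b\<close> occurs, with coefficient 1, exactly in the Schur functions of the
  shapes \<open>(n - q, q)\<close> with \<open>q \<le> b\<close>, so a difference of two coefficients of \<open>F\<close> isolates
  \<open>q = b\<close>.  No correction term arises when \<open>b = 0\<close>.
\<close>

lemma schur_coeff_length_le_2:
  assumes F: "symmetric_series F" and \<mu>: "is_partition \<mu>" "length \<mu> \<le> 2"
    and a: "a = nth_default 0 \<mu> 0" and b: "b = nth_default 0 \<mu> 1"
  shows "schur_coeff F \<mu> = F (Poly_Mapping.nth [a, b]) -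
    (if b = 0 then 0 else F (Poly_Mapping.nth [Suc a, b - 1]))"
proof -
  define n where "n = sum_list \<mu>"
  have n: "n = a + b" using sum_list_length_le_2[OF \<mu>(2)] by (simp add: n_def a b)
  have ba: "b \<le> a" using partition_antimono[OF \<mu>(1), of 0 1] by (simp add: a b)
  have coeff: "F (Poly_Mapping.nth [x, y]) =
      (\<Sum>\<nu>\<in>partitions_of n. c \<nu> * of_bool (length \<nu> \<le> 2 \<and> nth_default 0 \<nu> 1 \<le> y))"
    if "hom_component n F = (\<lambda>m. \<Sum>\<nu>\<in>partitions_of n. c \<nu> * schur \<nu> m)" "x + y = n" "y \<le> x"
    for c x y
  proof -
    have "F (Poly_Mapping.nth [x, y]) = hom_component n F (Poly_Mapping.nth [x, y])"
      using that(2) by (simp add: hom_component_def mdeg_nth)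
    also have "\<dots> = (\<Sum>\<nu>\<in>partitions_of n. c \<nu> * schur \<nu> (Poly_Mapping.nth [x, y]))"
      by (simp only: that(1))
    finally show ?thesis
      using that(2,3) by (simp add: partitions_of_def schur_two_letters)
  qed
  \<comment> \<open>The expansion \<open>c\<close> is arbitrary, so this settles uniqueness in the
    definite description.\<close>
  have unique: "c \<mu> = F (Poly_Mapping.nth [a, b]) -
      (if b = 0 then 0 else F (Poly_Mapping.nth [Suc a, b - 1]))"
    if c: "hom_component n F = (\<lambda>m. \<Sum>\<nu>\<in>partitions_of n. c \<nu> * schur \<nu> m)" for c
  proof -
    \<comment> \<open>The indicators of second part at most \<open>b\<close> and at most
      \<open>b - 1\<close> differ exactly where the second part is \<open>b\<close>.\<close>
    have "F (Poly_Mapping.nth [a, b]) - (if b = 0 then 0 else F (Poly_Mapping.nth [Suc a, b - 1]))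
        = (\<Sum>\<nu>\<in>partitions_of n. c \<nu> * of_bool (length \<nu> \<le> 2 \<and> nth_default 0 \<nu> 1 = b))"
      using coeff[OF c, of a b] coeff[OF c, of "Suc a" "b - 1"] n ba
      by (cases "b = 0") (auto simp: sum_subtractf[symmetric] intro!: sum.cong)
    also have "\<dots> = (\<Sum>\<nu>\<in>partitions_of n. if \<nu> = \<mu> then c \<mu> else 0)"
      using partition_length_le_2_eqI[of _ \<mu>] \<mu>
      by (intro sum.cong) (auto simp: partitions_of_def b n_def)
    also have "\<dots> = c \<mu>"
      using \<mu>(1) finite_partitions_of[of n] by simp (simp add: partitions_of_def n_def)
    finally show ?thesis by simp
  qed
  obtain c where c: "hom_component n F = (\<lambda>m. \<Sum>\<nu>\<in>partitions_of n. c \<nu> * schur \<nu> m)"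
    using schur_expansion[OF F, of n] by (rule exE)
  show ?thesis
    unfolding schur_coeff_def n_def[symmetric]
  proof (rule the_equality)
    show "\<exists>c. hom_component n F = (\<lambda>m. \<Sum>\<nu>\<in>partitions_of n. c \<nu> * schur \<nu> m) \<and>
        F (Poly_Mapping.nth [a, b]) - (if b = 0 then 0 else F (Poly_Mapping.nth [Suc a, b - 1])) = c \<mu>"
      using c unique[OF c] by (intro exI[of _ c]) simp
  qed (elim exE conjE, simp only: unique)
qed

lemma symmetric_inf_prod:
  assumes "poly P 0 = 1"
  shows "symmetric_series (inf_prod P)"
  unfolding symmetric_series_def inf_prod_eq[OF assms] lookup_map_key_transpose
  by (intro allI prod.reindex_bij_betw[OF bij_betw_keys_transpose])

text \<open>A zero exponent contributes the factor \<open>coeff P 0 = 1\<close>, so the product over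
  the support extends to both variables even if \<open>a\<close> or \<open>b\<close> is 0.\<close>

lemma inf_prod_two_letters:
  assumes "poly P 0 = 1"
  shows "inf_prod P (Poly_Mapping.nth [a, b]) = coeff P a * coeff P b"
proof -
  have "keys (Poly_Mapping.nth [a, b]) \<subseteq> {0, 1}"
    by (auto simp: in_keys_iff nth_default_def less_Suc_eq simp del: keys_nth split: if_splits)
  then have "inf_prod P (Poly_Mapping.nth [a, b]) =
      (\<Prod>i\<in>{0, 1}. coeff P (lookup (Poly_Mapping.nth [a, b]) i))"
    unfolding inf_prod_eq[OF assms] using assms
    by (intro prod.mono_neutral_left) (auto simp: in_keys_iff poly_0_coeff_0 simp del: keys_nth)
  then show ?thesis by (simp add: nth_default_def)
qed

section \<open>Log-concavity\<close>

text \<open>The ratios of consecutive coefficients do not increase; this is that fact for the ratios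
  at \<open>i\<close> and \<open>j\<close>, cross-multiplied. Positivity up to the degree permits
  the cancellation.\<close>

lemma log_concave_shift:
  assumes lc: "log_concave P" and pos: "\<And>j. j \<le> degree P \<Longrightarrow> coeff P j > 0"
    and "i \<le> j" "j < degree P"
  shows "coeff P i * coeff P (Suc j) \<le> coeff P (Suc i) * coeff P j"
  using assms(3,4)
proof (induction j rule: dec_induct)
  case base
  then show ?case by (simp add: mult.commute)
next
  case (step j)
  have p: "coeff P i > 0" "coeff P j > 0" "coeff P (Suc j) > 0" "coeff P (Suc i) > 0"
    using step by (auto intro!: pos)
  have "coeff P j * coeff P (Suc (Suc j)) \<le> (coeff P (Suc j))\<^sup>2"
    using lc step.prems unfolding log_concave_def by (auto dest!: spec[of _ "Suc j"])
  then have "coeff P i * (coeff P j * coeff P (Suc (Suc j))) \<le> coeff P i * (coeff P (Suc j))\<^sup>2"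
    using p by (intro mult_left_mono) auto
  also have "\<dots> = (coeff P i * coeff P (Suc j)) * coeff P (Suc j)"
    by (simp add: power2_eq_square)
  also have "\<dots> \<le> (coeff P (Suc i) * coeff P j) * coeff P (Suc j)"
    using p step by (intro mult_right_mono) auto
  finally have "coeff P j * (coeff P i * coeff P (Suc (Suc j))) \<le>
      coeff P j * (coeff P (Suc i) * coeff P (Suc j))"
    by (simp add: mult_ac)
  then show ?case using p by simp
qed

lemma strongly_log_concave_iff:
  assumes pos: "\<And>j. j \<le> degree P \<Longrightarrow> coeff P j > 0"
  shows "strongly_log_concave P \<longleftrightarrow> log_concave P"
proof
  assume "strongly_log_concave P"
  then show "log_concave P"
    unfolding strongly_log_concave_def log_concave_def
    by (intro allI impI) (simp add: power2_eq_square)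
next
  assume lc: "log_concave P"
  \<comment> \<open>With the index sum fixed, each inward move of both indices can only increase the
    product. Here \<open>k\<close> counts the moves and \<open>r\<close> is the final gap.\<close>
  have "coeff P p * coeff P (p + 2 * k + r) \<le> coeff P (p + k) * coeff P (p + k + r)"
    if "p + 2 * k + r \<le> degree P" for p k r
    using that
  proof (induction k arbitrary: p)
    case (Suc k)
    have "coeff P p * coeff P (Suc (p + 2 * k + r + 1)) \<le> coeff P (Suc p) * coeff P (p + 2 * k + r + 1)"
      using Suc.prems by (intro log_concave_shift[OF lc pos]) auto
    also have "\<dots> \<le> coeff P (Suc p + k) * coeff P (Suc p + k + r)"
      using Suc.IH[of "Suc p"] Suc.prems by simp
    finally show ?case by simp
  qed simp
  note * = this
  show "strongly_log_concave P"
    unfolding strongly_log_concave_def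
  proof (intro allI impI, elim conjE)
    fix p m n q
    assume "p < m" "m \<le> n" "n < q" "q \<le> degree P" "m + n = p + q"
    then have "m = p + (m - p)" "n = p + (m - p) + (n - m)" "q = p + 2 * (m - p) + (n - m)"
      by linarith+
    with \<open>q \<le> degree P\<close> show "coeff P p * coeff P q \<le> coeff P m * coeff P n"
      using *[of p "m - p" "n - m"] by metis
  qed
qed

theorem theorem1p3:
  fixes P :: "real poly"
  assumes "poly P 0 = 1"
    and "\<And>j. j \<le> degree P \<Longrightarrow> coeff P j > 0"
  shows "((\<forall>\<mu>. is_partition \<mu> \<and> length \<mu> \<le> 2 \<longrightarrow> schur_coeff (inf_prod P) \<mu> \<ge> 0)
            \<longleftrightarrow> (\<forall>k\<ge>1. schur_coeff (inf_prod P) [k, k] \<ge> 0))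
       \<and> ((\<forall>k\<ge>1. schur_coeff (inf_prod P) [k, k] \<ge> 0) \<longleftrightarrow> log_concave P)
       \<and> (log_concave P \<longleftrightarrow> strongly_log_concave P)"
proof -
  have slc: "strongly_log_concave P \<longleftrightarrow> log_concave P"
    by (rule strongly_log_concave_iff) (rule assms(2))
  have nonneg: "coeff P j \<ge> 0" for j
    using assms(2)[of j] by (cases "j \<le> degree P") (auto simp: coeff_eq_0)
  have two_row: "schur_coeff (inf_prod P) \<mu> = coeff P a * coeff P b -
      (if b = 0 then 0 else coeff P (Suc a) * coeff P (b - 1))"
    if "is_partition \<mu>" "length \<mu> \<le> 2" "a = nth_default 0 \<mu> 0" "b = nth_default 0 \<mu> 1" for \<mu> a b
    unfolding schur_coeff_length_le_2[OF symmetric_inf_prod[OF assms(1)] that]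
    by (simp add: inf_prod_two_letters[OF assms(1)])
  have kk: "is_partition [k, k]" if "k \<ge> 1" for k
    using that by (simp add: is_partition_def)
  have i_ii: "schur_coeff (inf_prod P) [k, k] \<ge> 0"
    if "\<forall>\<mu>. is_partition \<mu> \<and> length \<mu> \<le> 2 \<longrightarrow> schur_coeff (inf_prod P) \<mu> \<ge> 0" "k \<ge> 1" for k
    using that kk by simp
  have ii_iii: "log_concave P" if "\<forall>k\<ge>1. schur_coeff (inf_prod P) [k, k] \<ge> 0"
    unfolding log_concave_def
  proof (intro allI impI)
    fix j assume j: "1 \<le> j \<and> j < degree P"
    then have "0 \<le> schur_coeff (inf_prod P) [j, j]" using that by blast
    with j show "coeff P (j - 1) * coeff P (j + 1) \<le> (coeff P j)\<^sup>2"
      using two_row[OF kk, of j j j]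
      by (simp add: nth_default_def power2_eq_square mult.commute)
  qed
  have iii_i: "schur_coeff (inf_prod P) \<mu> \<ge> 0"
    if lc: "log_concave P" and \<mu>: "is_partition \<mu>" "length \<mu> \<le> 2" for \<mu>
  proof -
    define a b where "a = nth_default 0 \<mu> 0" and "b = nth_default 0 \<mu> 1"
    have ba: "b \<le> a" using partition_antimono[OF \<mu>(1), of 0 1] by (simp add: a_def b_def)
    have "coeff P (Suc a) * coeff P (b - 1) \<le> coeff P a * coeff P b" if "b \<noteq> 0"
    \<comment> \<open>Within the degree, strong log-concavity applies to the indices
      \<open>b - 1 < b \<le> a < Suc a\<close>; beyond it the left-hand product is 0.\<close>
    proof (cases "Suc a \<le> degree P")
      case True
      have "coeff P (b - 1) * coeff P (Suc a) \<le> coeff P b * coeff P a"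
        using lc[folded slc] True ba that unfolding strongly_log_concave_def
        by (elim allE[of _ "b - 1"] allE[of _ b] allE[of _ a] allE[of _ "Suc a"]) simp
      then show ?thesis by (simp add: mult.commute)
    qed (simp add: coeff_eq_0 nonneg)
    then show ?thesis
      unfolding two_row[OF \<mu> a_def b_def] by (simp add: nonneg)
  qed
  show ?thesis using i_ii ii_iii iii_i slc by blast
qed

end
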